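(* Let $X$ and $Y$ be Banach spaces and let $Z=X\oplus_1 Y$. If $Z$ has $BSCSP$, then either $X$ or $Y$ has $BSCSP$.
   Context: All Banach spaces are real and nontrivial. For a Banach space $E$, $B_E$ is the closed unit ball and $S_E$ the unit sphere. A slice of $B_E$ is a set $S(B_E,x^*,\alpha)=\{x\in B_E: x^*(x)>1-\alpha\}$ with $x^*\in S_{E^*}$ and $\alpha>0$. A convex combination of slices of $B_E$ is a set $\sum_{i=1}^n\lambda_i S_i$ (Minkowski sum), where each $S_i$ is a slice of $B_E$, $\lambda_i\ge 0$ and $\sum_{i=1}^n\lambda_i=1$. $E$ has the Ball Small Combination of Slice Property ($BSCSP$) if for every $\varepsilon>0$ there is a convex combination of slices of $B_E$ with diameter less than $\varepsilon$. $X\oplus_1 Y$ is $X\times Y$ with norm $\|(x,y)\|=\|x\|+\|y\|$. The word "or" is inclusive. *)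

theory Defs
  imports "HOL-Analysis.Analysis" "HOL-Library.Set_Algebras"
begin

text \<open>The library type \<open>'a \<times> 'b\<close> already carries the Euclidean product norm, so the
  \<open>\<ell>\<^sub>1\<close>-sum is a separate type.\<close>

datatype ('a, 'b) l1_sum = L1_Pair (l1_fst: 'a) (l1_snd: 'b)

instantiation l1_sum :: (real_normed_vector, real_normed_vector) real_normed_vector
begin

definition zero_l1_sum :: "('a, 'b) l1_sum" where
  "0 = L1_Pair 0 0"

definition plus_l1_sum :: "('a, 'b) l1_sum \<Rightarrow> ('a, 'b) l1_sum \<Rightarrow> ('a, 'b) l1_sum" where
  "x + y = L1_Pair (l1_fst x + l1_fst y) (l1_snd x + l1_snd y)"

definition minus_l1_sum :: "('a, 'b) l1_sum \<Rightarrow> ('a, 'b) l1_sum \<Rightarrow> ('a, 'b) l1_sum" where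
  "x - y = L1_Pair (l1_fst x - l1_fst y) (l1_snd x - l1_snd y)"

definition uminus_l1_sum :: "('a, 'b) l1_sum \<Rightarrow> ('a, 'b) l1_sum" where
  "- x = L1_Pair (- l1_fst x) (- l1_snd x)"

definition scaleR_l1_sum :: "real \<Rightarrow> ('a, 'b) l1_sum \<Rightarrow> ('a, 'b) l1_sum" where
  "r *\<^sub>R x = L1_Pair (r *\<^sub>R l1_fst x) (r *\<^sub>R l1_snd x)"

definition norm_l1_sum :: "('a, 'b) l1_sum \<Rightarrow> real" where
  "norm_l1_sum x = norm (l1_fst x) + norm (l1_snd x)"

definition dist_l1_sum :: "('a, 'b) l1_sum \<Rightarrow> ('a, 'b) l1_sum \<Rightarrow> real" where
  "dist_l1_sum x y = norm (x - y)"

definition sgn_l1_sum :: "('a, 'b) l1_sum \<Rightarrow> ('a, 'b) l1_sum" where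
  "sgn_l1_sum x = inverse (norm x) *\<^sub>R x"

definition uniformity_l1_sum :: "(('a, 'b) l1_sum \<times> ('a, 'b) l1_sum) filter" where
  "uniformity_l1_sum = (INF e\<in>{0 <..}. principal {(x, y). dist x y < e})"

definition open_l1_sum :: "('a, 'b) l1_sum set \<Rightarrow> bool" where
  "open_l1_sum U \<longleftrightarrow> (\<forall>x\<in>U. eventually (\<lambda>(x', y). x' = x \<longrightarrow> y \<in> U) uniformity)"

instance
proof
  fix x y :: "('a, 'b) l1_sum" and r :: real
  show "norm x = 0 \<longleftrightarrow> x = 0"
    by (cases x) (simp add: norm_l1_sum_def zero_l1_sum_def add_nonneg_eq_0_iff)
  show "norm (x + y) \<le> norm x + norm y"
    using norm_triangle_ineq[of "l1_fst x" "l1_fst y"] norm_triangle_ineq[of "l1_snd x" "l1_snd y"]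
    by (simp add: norm_l1_sum_def plus_l1_sum_def)
  show "norm (r *\<^sub>R x) = \<bar>r\<bar> * norm x"
    by (simp add: norm_l1_sum_def scaleR_l1_sum_def distrib_left)
qed (simp_all add: zero_l1_sum_def plus_l1_sum_def minus_l1_sum_def uminus_l1_sum_def
      scaleR_l1_sum_def dist_l1_sum_def sgn_l1_sum_def uniformity_l1_sum_def open_l1_sum_def
      algebra_simps)

end

instance l1_sum :: (banach, banach) banach
proof
  fix X :: "nat \<Rightarrow> ('a, 'b) l1_sum"
  assume X: "Cauchy X"
  have "Cauchy (\<lambda>n. l1_fst (X n))" "Cauchy (\<lambda>n. l1_snd (X n))"
    unfolding Cauchy_def
  proof safe
    fix e :: real assume "0 < e"
    with X obtain M where M: "dist (X m) (X n) < e" if "M \<le> m" "M \<le> n" for m n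
      unfolding Cauchy_def by meson
    have "dist (l1_fst (X m)) (l1_fst (X n)) < e" "dist (l1_snd (X m)) (l1_snd (X n)) < e"
      if "M \<le> m" "M \<le> n" for m n
      using M[OF that]
        norm_ge_zero[of "l1_fst (X m) - l1_fst (X n)"] norm_ge_zero[of "l1_snd (X m) - l1_snd (X n)"]
      by (simp_all add: dist_norm norm_l1_sum_def minus_l1_sum_def del: norm_ge_zero)
    then show "\<exists>M. \<forall>m\<ge>M. \<forall>n\<ge>M. dist (l1_fst (X m)) (l1_fst (X n)) < e"
      "\<exists>M. \<forall>m\<ge>M. \<forall>n\<ge>M. dist (l1_snd (X m)) (l1_snd (X n)) < e"
      by blast+
  qed
  then obtain a b where "(\<lambda>n. l1_fst (X n)) \<longlonglongrightarrow> a" "(\<lambda>n. l1_snd (X n)) \<longlonglongrightarrow> b"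
    by (auto simp: Cauchy_convergent_iff convergent_def)
  then have "(\<lambda>n. dist (l1_fst (X n)) a + dist (l1_snd (X n)) b) \<longlonglongrightarrow> 0 + 0"
    by (intro tendsto_add) (simp_all add: tendsto_dist_iff[symmetric])
  then have "(\<lambda>n. dist (X n) (L1_Pair a b)) \<longlonglongrightarrow> 0"
    by (simp add: dist_norm norm_l1_sum_def minus_l1_sum_def)
  then have "X \<longlonglongrightarrow> L1_Pair a b"
    by (simp add: tendsto_dist_iff[symmetric])
  then show "convergent X"
    by (rule convergentI)
qed

definition slice :: "('a::real_normed_vector \<Rightarrow>\<^sub>L real) \<Rightarrow> real \<Rightarrow> 'a set" where
  "slice f \<alpha> = {x \<in> cball 0 1. blinfun_apply f x > 1 - \<alpha>}"

definition is_slice :: "'a::real_normed_vector set \<Rightarrow> bool" where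
  "is_slice S \<longleftrightarrow> (\<exists>f \<alpha>. f \<in> sphere 0 1 \<and> \<alpha> > 0 \<and> S = slice f \<alpha>)"

text \<open>The sum of sets below is the Minkowski sum from \<^theory>\<open>HOL-Library.Set_Algebras\<close>.\<close>

definition is_convex_comb_slices :: "'a::real_normed_vector set \<Rightarrow> bool" where
  "is_convex_comb_slices C \<longleftrightarrow>
    (\<exists>(n::nat) (c :: nat \<Rightarrow> real) (S :: nat \<Rightarrow> 'a set).
        (\<forall>i<n. is_slice (S i)) \<and> (\<forall>i<n. 0 \<le> c i) \<and> (\<Sum>i<n. c i) = 1 \<and>
        C = (\<Sum>i<n. (\<lambda>x. c i *\<^sub>R x) ` S i))"

definition BSCSP :: "'a::real_normed_vector itself \<Rightarrow> bool" where
  "BSCSP _ \<longleftrightarrow> (\<forall>\<epsilon>>0. \<exists>C :: 'a set. is_convex_comb_slices C \<and> diameter C < \<epsilon>)"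

end

theory Submission
  imports Defs
begin

text \<open>A norm-one functional \<open>h\<close> on \<open>Z\<close> restricts to a norm-one functional on \<open>X\<close> or on \<open>Y\<close>.
  Given a small convex combination of slices of \<open>B\<^sub>Z\<close>, one of the two spaces, say \<open>X\<close>, thus
  receives norm-one restrictions from slices of total weight at least \<open>1/2\<close>. Each corresponding
  slice of \<open>B\<^sub>X\<close> embeds into that slice of \<open>B\<^sub>Z\<close>; fixing one point in each of the other slices and
  renormalising the weights gives a convex combination of slices of \<open>B\<^sub>X\<close> whose diameter is at
  most twice the original one.\<close>

section \<open>Slices, their convex combinations, and their pullback along an isometry\<close>

lemma is_slice_slice: "norm f = 1 \<Longrightarrow> \<alpha> > 0 \<Longrightarrow> is_slice (slice f \<alpha>)"
  unfolding is_slice_def by (intro exI[of _ f] exI[of _ \<alpha>]) simp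

text \<open>Otherwise \<open>f\<close> would be bounded by \<open>1 - \<alpha>\<close> on the unit
  ball, hence by homogeneity \<open>norm f \<le> 1 - \<alpha> < 1\<close>. This supplies the fixed
  points in the slices that are not pulled back.\<close>

lemma slice_nonempty:
  fixes f :: "'a::real_normed_vector \<Rightarrow>\<^sub>L real"
  assumes "norm f = 1" "\<alpha> > 0"
  shows "slice f \<alpha> \<noteq> {}"
proof
  assume empty: "slice f \<alpha> = {}"
  have le: "f x \<le> 1 - \<alpha>" if "norm x \<le> 1" for x
    using empty that by (force simp: slice_def not_less)
  \<comment> \<open>The origin also lies in the ball, so emptiness of the slice forces
    \<open>\<alpha> \<le> 1\<close>; the operator norm bound requires a nonnegative
    constant.\<close>
  have nonneg: "0 \<le> 1 - \<alpha>"
    using le[of 0] by simp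
  have bound: "f x \<le> (1 - \<alpha>) * norm x" for x
  proof (cases "x = 0")
    case False
    then have "f (x /\<^sub>R norm x) \<le> 1 - \<alpha>"
      by (intro le) simp
    then have "f x / norm x \<le> 1 - \<alpha>"
      by (simp add: blinfun.scaleR_right divide_inverse mult.commute)
    then show ?thesis
      using False by (simp add: pos_divide_le_eq)
  qed simp
  have "norm (f x) \<le> (1 - \<alpha>) * norm x" for x
    using bound[of x] bound[of "- x"] by (simp add: blinfun.minus_right abs_le_iff)
  then have "norm f \<le> 1 - \<alpha>"
    by (intro norm_blinfun_bound nonneg)
  with assms show False
    by simp
qed

text \<open>Points are chosen in the unscaled sets \<open>S i\<close>, so that they can be replaced
  index by index while the weights change independently.\<close>

lemma mem_sum_scaled_sets_iff:
  fixes S :: "nat \<Rightarrow> 'a::real_vector set"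
  shows "u \<in> (\<Sum>i<n. (\<lambda>x. c i *\<^sub>R x) ` S i) \<longleftrightarrow>
    (\<exists>x. (\<forall>i<n. x i \<in> S i) \<and> u = (\<Sum>i<n. c i *\<^sub>R x i))"
proof
  assume "u \<in> (\<Sum>i<n. (\<lambda>x. c i *\<^sub>R x) ` S i)"
  then obtain s where s: "u = sum s {..<n}" "\<forall>i\<in>{..<n}. s i \<in> (\<lambda>x. c i *\<^sub>R x) ` S i"
    by (auto simp: set_sum_alt)
  then have "\<forall>i\<in>{..<n}. \<exists>y. y \<in> S i \<and> s i = c i *\<^sub>R y"
    by blast
  then obtain x where "\<forall>i\<in>{..<n}. x i \<in> S i \<and> s i = c i *\<^sub>R x i"
    by (rule bchoice[THEN exE])
  with s show "\<exists>x. (\<forall>i<n. x i \<in> S i) \<and> u = (\<Sum>i<n. c i *\<^sub>R x i)"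
    by (intro exI[of _ x]) simp
next
  assume "\<exists>x. (\<forall>i<n. x i \<in> S i) \<and> u = (\<Sum>i<n. c i *\<^sub>R x i)"
  then obtain x where "\<forall>i<n. x i \<in> S i" "u = (\<Sum>i<n. c i *\<^sub>R x i)"
    by (elim exE conjE)
  then show "u \<in> (\<Sum>i<n. (\<lambda>x. c i *\<^sub>R x) ` S i)"
    unfolding set_sum_alt[OF finite_lessThan]
    by (intro CollectI exI[of _ "\<lambda>i. c i *\<^sub>R x i"] conjI ballI imageI) simp_all
qed

lemma is_convex_comb_slicesI:
  fixes n :: nat
  assumes "\<And>i. i < n \<Longrightarrow> is_slice (S i)" "\<And>i. i < n \<Longrightarrow> 0 \<le> c i" "(\<Sum>i<n. c i) = 1"
  shows "is_convex_comb_slices (\<Sum>i<n. (\<lambda>x. c i *\<^sub>R x) ` S i)"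
  unfolding is_convex_comb_slices_def using assms
  by (intro exI[of _ n] exI[of _ c] exI[of _ S]) simp

text \<open>Slices lie in the unit ball, which is convex. Boundedness is what lets
  \<open>diameter\<close> control distances between points.\<close>

lemma bounded_convex_comb_slices:
  assumes "is_convex_comb_slices C"
  shows "bounded C"
proof -
  obtain n c S where S: "\<forall>i<(n::nat). is_slice (S i)" and c: "\<forall>i<n. 0 \<le> c i" "(\<Sum>i<n. c i) = 1"
    and C: "C = (\<Sum>i<n. (\<lambda>x. c i *\<^sub>R x) ` S i)"
    using assms unfolding is_convex_comb_slices_def by blast
  have "norm u \<le> 1" if "u \<in> C" for u
  proof -
    obtain x where x: "\<forall>i<n. x i \<in> S i" and u: "u = (\<Sum>i<n. c i *\<^sub>R x i)"
      using \<open>u \<in> C\<close> unfolding C mem_sum_scaled_sets_iff by blast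
    have "norm (c i *\<^sub>R x i) \<le> c i" if "i < n" for i
    proof -
      have "x i \<in> S i" "is_slice (S i)"
        using x S that by blast+
      then have "norm (x i) \<le> 1"
        by (auto simp: is_slice_def slice_def)
      with c(1) that show ?thesis
        by (simp add: mult_left_le)
    qed
    then have "norm u \<le> (\<Sum>i<n. c i)"
      unfolding u by (intro sum_norm_le) simp
    then show ?thesis
      using c by simp
  qed
  then show ?thesis
    by (auto simp: bounded_iff)
qed

text \<open>The isometry \<open>e\<close> maps the slice of \<open>h i o\<^sub>L e\<close> into the
  slice of \<open>h i\<close> with the same \<open>\<alpha> i\<close>. Two points of
  \<open>C\<close> that agree outside \<open>I\<close> differ by \<open>w\<close> times the image of
  a difference in \<open>D\<close>, where \<open>w \<ge> 1/2\<close> is the weight of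
  \<open>I\<close>; dividing by \<open>w\<close> costs at most the factor 2.\<close>

lemma convex_comb_slices_pullback:
  fixes e :: "'a::real_normed_vector \<Rightarrow>\<^sub>L 'b::real_normed_vector" and n :: nat
  assumes iso: "\<And>x. norm (e x) = norm x"
    and h: "\<And>i. i < n \<Longrightarrow> norm (h i) = 1"
    and \<alpha>: "\<And>i. i < n \<Longrightarrow> \<alpha> i > 0"
    and c: "\<And>i. i < n \<Longrightarrow> 0 \<le> c i" "(\<Sum>i<n. c i) = 1"
    and I: "I \<subseteq> {..<n}" "\<And>i. i \<in> I \<Longrightarrow> norm (h i o\<^sub>L e) = 1"
    and half: "(\<Sum>i\<in>I. c i) \<ge> 1/2"
    and C: "C = (\<Sum>i<n. (\<lambda>x. c i *\<^sub>R x) ` slice (h i) (\<alpha> i))"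
  obtains D :: "'a set" where "is_convex_comb_slices D" "diameter D \<le> 2 * diameter C"
proof -
  define w where "w = (\<Sum>i\<in>I. c i)"
  have w: "w \<ge> 1/2"
    using half by (simp add: w_def)
  then have "I \<noteq> {}"
    by (auto simp: w_def)
  then obtain k where k: "k \<in> I"
    by blast
  \<comment> \<open>Outside \<open>I\<close> the functional \<open>h i o\<^sub>L e\<close> may fail
    to have norm one, so the slice at \<open>k\<close> stands in for it. The weight
    \<open>b i\<close> is zero there, and the index range stays \<open>{..<n}\<close>.\<close>
  define j where "j i = (if i \<in> I then i else k)" for i
  have j: "j i \<in> I" "j i < n" for i
    using k I(1) by (auto simp: j_def)
  define b where "b i = (if i \<in> I then c i / w else 0)" for i
  define T where "T i = slice (h (j i) o\<^sub>L e) (\<alpha> (j i))" for i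
  define D where "D = (\<Sum>i<n. (\<lambda>x. b i *\<^sub>R x) ` T i)"
  have "(\<Sum>i<n. b i) = (\<Sum>i\<in>I. c i / w)"
    unfolding b_def using I(1) by (intro sum.mono_neutral_cong_right) auto
  also have "\<dots> = 1"
    using w by (simp add: w_def flip: sum_divide_distrib)
  finally have sum_b: "(\<Sum>i<n. b i) = 1" .
  have comb: "is_convex_comb_slices D"
    unfolding D_def
  proof (rule is_convex_comb_slicesI)
    show "is_slice (T i)" for i
      unfolding T_def by (intro is_slice_slice I(2) \<alpha> j)
    show "0 \<le> b i" if "i < n" for i
      using c(1)[OF that] w by (simp add: b_def)
  qed (rule sum_b)
  have bdd: "bounded C"
    unfolding C by (intro bounded_convex_comb_slices is_convex_comb_slicesI is_slice_slice h \<alpha> c)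
  define z where "z i = (SOME x. x \<in> slice (h i) (\<alpha> i))" for i
  have z: "z i \<in> slice (h i) (\<alpha> i)" if "i < n" for i
    unfolding z_def some_in_eq by (intro slice_nonempty h \<alpha> that)
  have mem: "(\<Sum>i<n. c i *\<^sub>R (if i \<in> I then e (x i) else z i)) \<in> C"
    if "\<forall>i<n. x i \<in> T i" for x
  proof -
    have "e (x i) \<in> slice (h i) (\<alpha> i)" if "i \<in> I" for i
    proof -
      have "x i \<in> T i"
        using \<open>\<forall>i<n. x i \<in> T i\<close> I(1) that by auto
      then show ?thesis
        using that by (simp add: T_def j_def slice_def iso)
    qed
    then show ?thesis
      unfolding C mem_sum_scaled_sets_iff using z
      by (intro exI[of _ "\<lambda>i. if i \<in> I then e (x i) else z i"]) auto
  qed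
  have dist_le: "dist u v \<le> 2 * diameter C" if "u \<in> D" "v \<in> D" for u v
  proof -
    obtain x where x: "\<forall>i<n. x i \<in> T i" and u: "u = (\<Sum>i<n. b i *\<^sub>R x i)"
      using \<open>u \<in> D\<close> unfolding D_def mem_sum_scaled_sets_iff by blast
    obtain y where y: "\<forall>i<n. y i \<in> T i" and v: "v = (\<Sum>i<n. b i *\<^sub>R y i)"
      using \<open>v \<in> D\<close> unfolding D_def mem_sum_scaled_sets_iff by blast
    let ?p = "\<lambda>x. \<Sum>i<n. c i *\<^sub>R (if i \<in> I then e (x i) else z i)"
    \<comment> \<open>The points \<open>z i\<close> cancel outside \<open>I\<close>, where
      \<open>b i = 0\<close>; on \<open>I\<close> one has \<open>w * b i = c i\<close>.\<close>
    have "?p x - ?p y = (\<Sum>i<n. w *\<^sub>R e (b i *\<^sub>R (x i - y i)))"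
      unfolding sum_subtractf[symmetric]
      using w by (intro sum.cong) (auto simp: b_def blinfun.bilinear_simps scaleR_diff_right)
    also have "\<dots> = w *\<^sub>R e (u - v)"
      by (simp add: u v blinfun.sum_right scaleR_sum_right scaleR_diff_right sum_subtractf
          blinfun.diff_right)
    finally have "dist (?p x) (?p y) = w * dist u v"
      using w iso by (simp add: dist_norm)
    moreover have "dist (?p x) (?p y) \<le> diameter C"
      using bdd mem[OF x] mem[OF y] by (rule diameter_bounded_bound)
    moreover have "1/2 * dist u v \<le> w * dist u v"
      using w by (intro mult_right_mono) auto
    ultimately show ?thesis
      by linarith
  qed
  \<comment> \<open>Nonnegativity of the bound meets the side condition of
    \<open>diameter_le\<close>, so no point of \<open>D\<close> has to be exhibited.\<close>
  have "diameter D \<le> 2 * diameter C"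
    using dist_le diameter_ge_0[OF bdd] by (intro diameter_le) (auto simp: dist_norm)
  with comb show thesis
    by (rule that)
qed

section \<open>The two summands inside the sum, and the dual norm\<close>

lemma bounded_linear_L1_Pair_left: "bounded_linear (\<lambda>x. L1_Pair x 0)"
  by (rule bounded_linear_intro[where K = 1])
    (simp_all add: plus_l1_sum_def scaleR_l1_sum_def norm_l1_sum_def)

lemma bounded_linear_L1_Pair_right: "bounded_linear (\<lambda>y. L1_Pair 0 y)"
  by (rule bounded_linear_intro[where K = 1])
    (simp_all add: plus_l1_sum_def scaleR_l1_sum_def norm_l1_sum_def)

text \<open>As a bounded linear map, the embedding can be composed with a functional, which
  expresses restriction to the summand.\<close>

lift_definition l1_inl :: "'a::real_normed_vector \<Rightarrow>\<^sub>L ('a, 'b::real_normed_vector) l1_sum"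
  is "\<lambda>x. L1_Pair x 0"
  by (rule bounded_linear_L1_Pair_left)

lift_definition l1_inr :: "'b::real_normed_vector \<Rightarrow>\<^sub>L ('a::real_normed_vector, 'b) l1_sum"
  is "\<lambda>y. L1_Pair 0 y"
  by (rule bounded_linear_L1_Pair_right)

lemma norm_l1_inl [simp]: "norm (l1_inl x) = norm x"
  by transfer (simp add: norm_l1_sum_def)

lemma norm_l1_inr [simp]: "norm (l1_inr y) = norm y"
  by transfer (simp add: norm_l1_sum_def)

lemma l1_sum_decomp: "z = l1_inl (l1_fst z) + l1_inr (l1_snd z)"
  by transfer (simp add: plus_l1_sum_def)

lemma norm_blinfun_compose_isometry_le:
  assumes "\<And>x. norm (blinfun_apply e x) = norm x"
  shows "norm (h o\<^sub>L e) \<le> norm h"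
proof (rule norm_blinfun_bound)
  show "norm ((h o\<^sub>L e) x) \<le> norm h * norm x" for x
    using norm_blinfun[of h "e x"] by (simp add: assms)
qed simp

text \<open>The dual of an \<open>l1\<close>-sum carries the maximum norm: one inequality splits
  \<open>z\<close> into its components, the other holds because both embeddings are
  isometric.\<close>

lemma norm_l1_functional:
  fixes h :: "('a::real_normed_vector, 'b::real_normed_vector) l1_sum \<Rightarrow>\<^sub>L real"
  shows "norm h = max (norm (h o\<^sub>L l1_inl)) (norm (h o\<^sub>L l1_inr))"
proof (rule antisym)
  let ?f = "h o\<^sub>L l1_inl" and ?g = "h o\<^sub>L l1_inr"
  let ?m = "max (norm ?f) (norm ?g)"
  show "norm h \<le> ?m"
  proof (rule norm_blinfun_bound)
    fix z
    have "h z = ?f (l1_fst z) + ?g (l1_snd z)"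
      by (subst l1_sum_decomp) (simp add: blinfun.add_right)
    then have "norm (h z) \<le> norm (?f (l1_fst z)) + norm (?g (l1_snd z))"
      by (metis norm_triangle_ineq)
    also have "\<dots> \<le> norm ?f * norm (l1_fst z) + norm ?g * norm (l1_snd z)"
      by (intro add_mono norm_blinfun)
    also have "\<dots> \<le> ?m * norm (l1_fst z) + ?m * norm (l1_snd z)"
      by (intro add_mono mult_right_mono) auto
    finally show "norm (h z) \<le> ?m * norm z"
      by (simp add: norm_l1_sum_def distrib_left)
  qed (simp add: le_max_iff_disj)
qed (simp add: norm_blinfun_compose_isometry_le)

lemma l1_sum_convex_comb_slices:
  fixes C :: "('a::real_normed_vector, 'b::real_normed_vector) l1_sum set"
  assumes "is_convex_comb_slices C"
  shows "(\<exists>D::'a set. is_convex_comb_slices D \<and> diameter D \<le> 2 * diameter C) \<or>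
    (\<exists>D::'b set. is_convex_comb_slices D \<and> diameter D \<le> 2 * diameter C)"
proof -
  obtain n c S where S: "\<forall>i<(n::nat). is_slice (S i)"
    and c: "\<And>i. i < n \<Longrightarrow> 0 \<le> c i" "(\<Sum>i<n. c i) = 1"
    and C: "C = (\<Sum>i<n. (\<lambda>x. c i *\<^sub>R x) ` S i)"
    using assms unfolding is_convex_comb_slices_def by blast
  obtain h \<alpha> where h: "\<And>i. i < n \<Longrightarrow> norm (h i) = 1" and \<alpha>: "\<And>i. i < n \<Longrightarrow> \<alpha> i > 0"
    and Sh: "\<And>i. i < n \<Longrightarrow> S i = slice (h i) (\<alpha> i)"
  proof -
    have "\<forall>i. \<exists>f \<beta>. i < n \<longrightarrow> norm f = 1 \<and> \<beta> > 0 \<and> S i = slice f \<beta>"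
      using S by (force simp: is_slice_def)
    then show ?thesis
      using that by metis
  qed
  have C': "C = (\<Sum>i<n. (\<lambda>x. c i *\<^sub>R x) ` slice (h i) (\<alpha> i))"
    unfolding C by (intro sum.cong) (simp_all add: Sh)
  \<comment> \<open>Since the norm of \<open>h i\<close> is a maximum, an index outside
    \<open>I\<close> has a norm-one restriction to the second summand. Ties go to \<open>I\<close>,
    so \<open>I\<close> and \<open>J\<close> partition the indices and one of them carries weight at
    least \<open>1/2\<close>.\<close>
  define I where "I = {i. i < n \<and> norm (h i o\<^sub>L l1_inl) = 1}"
  define J where "J = {..<n} - I"
  have I: "I \<subseteq> {..<n}" "\<And>i. i \<in> I \<Longrightarrow> norm (h i o\<^sub>L l1_inl) = 1"
    by (auto simp: I_def)
  have J: "J \<subseteq> {..<n}" "\<And>i. i \<in> J \<Longrightarrow> norm (h i o\<^sub>L l1_inr) = 1"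
  proof -
    show "J \<subseteq> {..<n}"
      by (auto simp: J_def)
    fix i
    assume "i \<in> J"
    then have "i < n" "norm (h i o\<^sub>L l1_inl) \<noteq> 1"
      by (auto simp: J_def I_def)
    then show "norm (h i o\<^sub>L l1_inr) = 1"
      using h[OF \<open>i < n\<close>] norm_l1_functional[of "h i"] by linarith
  qed
  have "(\<Sum>i\<in>I. c i) + (\<Sum>i\<in>J. c i) = 1"
    using c(2) sum.subset_diff[OF I(1), of c] by (simp add: J_def)
  then consider "(\<Sum>i\<in>I. c i) \<ge> 1/2" | "(\<Sum>i\<in>J. c i) \<ge> 1/2"
    by linarith
  then show ?thesis
  proof cases
    case 1
    show ?thesis
      by (rule convex_comb_slices_pullback[OF norm_l1_inl h \<alpha> c I 1 C']) auto
  next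
    case 2
    show ?thesis
      by (rule convex_comb_slices_pullback[OF norm_l1_inr h \<alpha> c J 2 C']) auto
  qed
qed

theorem proposition2p14:
  assumes "\<exists>x::'x::banach. x \<noteq> 0"
    and "\<exists>y::'y::banach. y \<noteq> 0"
    and "BSCSP TYPE(('x, 'y) l1_sum)"
  shows "BSCSP TYPE('x) \<or> BSCSP TYPE('y)"
proof (rule ccontr)
  assume "\<not> (BSCSP TYPE('x) \<or> BSCSP TYPE('y))"
  then obtain \<epsilon> \<delta> where pos: "\<epsilon> > 0" "\<delta> > 0"
    and X: "\<And>D::'x set. is_convex_comb_slices D \<Longrightarrow> diameter D \<ge> \<epsilon>"
    and Y: "\<And>D::'y set. is_convex_comb_slices D \<Longrightarrow> diameter D \<ge> \<delta>"
    unfolding BSCSP_def by (meson not_less)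
  \<comment> \<open>Which summand inherits a small combination depends on \<open>C\<close>, so a
    single threshold must contradict both failures; halving absorbs the factor 2.\<close>
  have "min \<epsilon> \<delta> / 2 > 0"
    using pos by simp
  then obtain C :: "('x, 'y) l1_sum set" where C: "is_convex_comb_slices C" "diameter C < min \<epsilon> \<delta> / 2"
    using assms(3) unfolding BSCSP_def by blast
  from l1_sum_convex_comb_slices[OF C(1)] show False
  proof (elim disjE exE conjE)
    fix D :: "'x set"
    assume "is_convex_comb_slices D" "diameter D \<le> 2 * diameter C"
    with X[of D] C(2) show False
      by linarith
  next
    fix D :: "'y set"
    assume "is_convex_comb_slices D" "diameter D \<le> 2 * diameter C"
    with Y[of D] C(2) show False
      by linarith
  qed
qed

end
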